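(* Let $s\in(0,1)$ and $\Omega=B_1^{n-1}\times\mathbb{R}\subseteq\mathbb{R}^{n-1}\times\mathbb{R}$. Let $E\subseteq\mathbb{R}^n$ and let $\Sigma\subseteq\Omega^c\cap E^c$ be a bounded set. Assume that there exist a small $\delta>0$, a function $\psi\in C^{1,\alpha}(\mathbb{R}^{n-1})$ with $\alpha\in(0,1)$, and a vertical translation $\tau_n$ such that $$E=\operatorname{subgraph}(\psi)\quad\text{in }\Omega_\delta\setminus\Omega$$ and $$\tau_n(\Sigma)\cap\Big[\big(B^{n-1}_{1+\delta}\setminus\overline{B^{n-1}_1}\big)\times\mathbb{R}\Big]\subseteq G_{C,\xi},$$ where $$G_{C,\xi}:=\big\{(x',x_n)\in\mathbb{R}^n:\ 1<|x'|<1+\delta,\ \psi(x')<x_n<\psi(x')+C(|x'|-1)^{n+s-1+\xi}\big\}$$ for some $C>0$ and $\xi>0$. Then $E$ is a $\Lambda$-minimizer for $\operatorname{Per}_s(\cdot,\Omega)$ with external datum $E\setminus\Omega$, for some $\Lambda\ge0$, if and only if $\widetilde E:=E\cup\Sigma$ is a $\widetilde\Lambda$-minimizer for $\operatorname{Per}_s(\cdot,\Omega)$ with external datum $\widetilde E\setminus\Omega$, for some $\widetilde\Lambda\ge0$.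
   Context: $n\ge2$; points are written $x=(x',x_n)\in\mathbb{R}^{n-1}\times\mathbb{R}$; $B^{n-1}_r$ is the open ball of radius $r$ centered at $0$ in $\mathbb{R}^{n-1}$. All sets are Lebesgue measurable. $\Omega_\delta=\{x\in\mathbb{R}^n:\operatorname{dist}(x,\Omega)<\delta\}$; $\operatorname{subgraph}(\psi)=\{(x',x_n):x_n<\psi(x')\}$; "$E=F$ in $U$" means $E\cap U=F\cap U$; a vertical translation is a map $x\mapsto x+te_n$, $t\in\mathbb{R}$. For disjoint $A,B\subseteq\mathbb{R}^n$, $\mathcal{L}(A,B):=\int_A\int_B\frac{dx\,dy}{|x-y|^{n+s}}$; $\operatorname{Per}_s(E,K):=\mathcal{L}(E\cap K,E^c)+\mathcal{L}(E\cap K^c,E^c\cap K)$. For a bounded open Lipschitz set $K$ and $\Lambda\ge0$, $E$ is $\Lambda$-minimal (a $\Lambda$-minimizer) in $K$ if $\operatorname{Per}_s(E,K)<+\infty$ and $\operatorname{Per}_s(E,K)\le\operatorname{Per}_s(F,K)+\Lambda|E\Delta F|$ for every $F$ with $E\Delta F\subseteq K$. Since $\Omega$ is unbounded, $E$ is a $\Lambda$-minimizer for $\operatorname{Per}_s(\cdot,\Omega)$ if it is $\Lambda$-minimal in every bounded Lipschitz set $K\subseteq\Omega$. The "external datum" of $E$ is the set $E\setminus\Omega$. *)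

theory Defs
  imports "HOL-Analysis.Analysis"
begin

text \<open>
  Points of \<open>\<real>\<^sup>n = \<real>\<^sup>n\<^sup>-\<^sup>1 \<times> \<real>\<close> are elements of a product type \<open>'a \<times> real\<close>, where \<open>'a\<close> is a
  Euclidean space of dimension \<open>n - 1 \<ge> 1\<close>; the product carries the Euclidean norm, and
  \<open>DIM('a \<times> real) = n\<close>.
\<close>

definition subgraph :: "('a::euclidean_space \<Rightarrow> real) \<Rightarrow> ('a \<times> real) set" where
  "subgraph \<psi> = {(x', xn). xn < \<psi> x'}"

definition eq_in :: "'b set \<Rightarrow> 'b set \<Rightarrow> 'b set \<Rightarrow> bool" where
  "eq_in U E F \<longleftrightarrow> E \<inter> U = F \<inter> U"

definition vertical_translation ::
    "(('a::euclidean_space \<times> real) \<Rightarrow> ('a \<times> real)) \<Rightarrow> bool" where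
  "vertical_translation \<tau> \<longleftrightarrow> (\<exists>t::real. \<tau> = (\<lambda>x. x + t *\<^sub>R (0, 1)))"

definition enlargement :: "real \<Rightarrow> 'b::metric_space set \<Rightarrow> 'b set" where
  "enlargement \<delta> A = {x. infdist x A < \<delta>}"

definition cylinder :: "('a::euclidean_space \<times> real) set" where
  "cylinder = ball 0 1 \<times> UNIV"

text \<open>
  \<open>C\<^sup>1\<^sup>,\<^sup>\<alpha>(\<real>\<^sup>n\<^sup>-\<^sup>1)\<close> is read in the local sense (the gradient is \<open>\<alpha>\<close>-Hoelder on compact sets),
  as usual for spaces over an open set; no bound at infinity is imposed.
\<close>

definition C1_Holder :: "real \<Rightarrow> ('a::euclidean_space \<Rightarrow> real) \<Rightarrow> bool" where
  "C1_Holder \<alpha> \<psi> \<longleftrightarrow>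
     (\<exists>D. (\<forall>x. GDERIV \<psi> x :> D x) \<and>
          (\<forall>K. compact K \<longrightarrow>
             (\<exists>H. \<forall>x\<in>K. \<forall>y\<in>K. norm (D x - D y) \<le> H * norm (x - y) powr \<alpha>)))"

text \<open>
  Open sets that near each boundary point are, up to an orthogonal change of coordinates,
  the subgraph of a Lipschitz function.
\<close>

definition open_Lipschitz :: "('a::euclidean_space \<times> real) set \<Rightarrow> bool" where
  "open_Lipschitz K \<longleftrightarrow>
     open K \<and>
     (\<forall>p\<in>frontier K. \<exists>U (T :: 'a \<times> real \<Rightarrow> 'a \<times> real) (g :: 'a \<Rightarrow> real) L.
        open U \<and> p \<in> U \<and> orthogonal_transformation T \<and> L-lipschitz_on UNIV g \<and>
        eq_in U K (T -` subgraph g))"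

text \<open>The value of the kernel on the diagonal is irrelevant: the sets are disjoint.\<close>

definition interaction ::
    "real \<Rightarrow> 'b::euclidean_space set \<Rightarrow> 'b set \<Rightarrow> ennreal" where
  "interaction s A B =
     (\<integral>\<^sup>+x\<in>A. (\<integral>\<^sup>+y\<in>B. ennreal (1 / norm (x - y) powr (real DIM('b) + s)) \<partial>lebesgue) \<partial>lebesgue)"

definition Per :: "real \<Rightarrow> 'b::euclidean_space set \<Rightarrow> 'b set \<Rightarrow> ennreal" where
  "Per s E K = interaction s (E \<inter> K) (- E) + interaction s (E \<inter> - K) (- E \<inter> K)"

definition Lambda_minimal_in ::
    "real \<Rightarrow> real \<Rightarrow> 'b::euclidean_space set \<Rightarrow> 'b set \<Rightarrow> bool" where
  "Lambda_minimal_in s \<Lambda> K E \<longleftrightarrow>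
     Per s E K < \<infinity> \<and>
     (\<forall>F\<in>sets lebesgue. sym_diff E F \<subseteq> K \<longrightarrow>
        Per s E K \<le> Per s F K + ennreal \<Lambda> * emeasure lebesgue (sym_diff E F))"

text \<open>\<open>E\<close> is a \<open>\<Lambda>\<close>-minimizer for \<open>Per\<^sub>s(\<cdot>, \<Omega>)\<close> with external datum \<open>D\<close>, for unbounded \<open>\<Omega>\<close>.\<close>

definition Lambda_minimizer ::
    "real \<Rightarrow> real \<Rightarrow> ('a::euclidean_space \<times> real) set \<Rightarrow> ('a \<times> real) set \<Rightarrow>
     ('a \<times> real) set \<Rightarrow> bool" where
  "Lambda_minimizer s \<Lambda> \<Omega> D E \<longleftrightarrow>
     E - \<Omega> = D \<and>
     (\<forall>K. bounded K \<and> open_Lipschitz K \<and> K \<subseteq> \<Omega> \<longrightarrow> Lambda_minimal_in s \<Lambda> K E)"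

definition thin_region ::
    "real \<Rightarrow> ('a::euclidean_space \<Rightarrow> real) \<Rightarrow> real \<Rightarrow> real \<Rightarrow> real \<Rightarrow> ('a \<times> real) set" where
  "thin_region s \<psi> \<delta> C \<xi> =
     {(x', xn). 1 < norm x' \<and> norm x' < 1 + \<delta> \<and> \<psi> x' < xn \<and>
        xn < \<psi> x' + C * (norm x' - 1) powr (real DIM('a \<times> real) + s - 1 + \<xi>)}"

end

theory Submission
  imports Defs
begin

text \<open>
  For a competitor \<open>F\<close> of \<open>E\<close> in \<open>K\<close>, passing from \<open>E, F\<close> to \<open>E \<union> S, F \<union> S\<close> changes the difference of
  the perimeters by at most \<open>2 \<L>(E \<Delta> F, S)\<close>. This is at most \<open>2 M |E \<Delta> F|\<close> as soon as the
  potential \<open>x \<mapsto> \<integral>\<^sub>S |x - y|\<^sup>-\<^sup>n\<^sup>-\<^sup>s dy\<close> is bounded by \<open>M\<close> on \<open>\<Omega>\<close>. Since \<open>|x - y| \<ge> |y'| - 1\<close> for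
  \<open>x \<in> \<Omega>\<close>, only the vertical thickness of \<open>S\<close> matters, which is why the translation is harmless:
  the part of \<open>S\<close> close to \<open>\<Omega>\<close> contributes at most
  \<open>C \<integral>\<^bsub>1<|y'|<1+\<delta>\<^esub> (|y'| - 1)\<^bsup>\<xi> - 1\<^esup> dy' < \<infinity>\<close>.
\<close>

section \<open>The nonlocal interaction\<close>

text \<open>Needed for Tonelli on Lebesgue measurable sets. A countable exhaustion for
  \<open>lborel\<close> still serves, because completion keeps Borel sets and their
  measures.\<close>

lemma sigma_finite_lebesgue: "sigma_finite_measure (lebesgue :: 'a::euclidean_space measure)"
proof
  obtain A :: "'a set set" where A: "countable A" "A \<subseteq> sets lborel" "\<Union>A = space lborel"
      "\<forall>a\<in>A. emeasure lborel a \<noteq> \<infinity>"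
    using lborel.sigma_finite_countable by blast
  have "A \<subseteq> sets lebesgue"
    using A(2) by (meson sets_completionI_sets subset_iff)
  moreover have "\<forall>a\<in>A. emeasure lebesgue a \<noteq> \<infinity>"
    using A(2,4) by (simp add: subset_iff)
  ultimately show "\<exists>A::'a set set. countable A \<and> A \<subseteq> sets lebesgue \<and> \<Union>A = space lebesgue \<and>
      (\<forall>a\<in>A. emeasure lebesgue a \<noteq> \<infinity>)"
    using A by auto
qed

lemma pair_sigma_finite_lebesgue:
  "pair_sigma_finite (lebesgue :: 'a::euclidean_space measure) (lebesgue :: 'b::euclidean_space measure)"
  by (intro pair_sigma_finite.intro sigma_finite_lebesgue)

abbreviation fractional_kernel :: "real \<Rightarrow> 'b::euclidean_space \<Rightarrow> 'b \<Rightarrow> ennreal" where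
  "fractional_kernel s x y \<equiv> ennreal (1 / norm (x - y) powr (real DIM('b) + s))"

text \<open>The kernel is a Borel function of the two projections, so it suffices that each
  projection is measurable from the product of the completed spaces to \<open>borel\<close>.\<close>

lemma borel_measurable_fractional_kernel [measurable]:
  "(\<lambda>z::'b::euclidean_space \<times> 'b. fractional_kernel s (fst z) (snd z)) \<in> borel_measurable (lebesgue \<Otimes>\<^sub>M lebesgue)"
proof -
  have [measurable]: "(fst :: 'b \<times> 'b \<Rightarrow> 'b) \<in> lebesgue \<Otimes>\<^sub>M lebesgue \<rightarrow>\<^sub>M borel"
      "(snd :: 'b \<times> 'b \<Rightarrow> 'b) \<in> lebesgue \<Otimes>\<^sub>M lebesgue \<rightarrow>\<^sub>M borel"
    using measurable_compose[OF measurable_fst, of "\<lambda>x. x" lebesgue borel lebesgue]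
      measurable_compose[OF measurable_snd, of "\<lambda>x. x" lebesgue borel lebesgue]
    by (auto simp: measurable_completion)
  show ?thesis
    by measurable
qed

text \<open>As a single integral over the product space, the interaction inherits additivity from
  the indicators and symmetry from Tonelli.\<close>

lemma interaction_eq_nn_integral_prod:
  assumes [measurable]: "A \<in> sets lebesgue" "B \<in> sets lebesgue"
  shows "interaction s A B =
    (\<integral>\<^sup>+z. fractional_kernel s (fst z) (snd z) * (indicator A (fst z) * indicator B (snd z)) \<partial>(lebesgue \<Otimes>\<^sub>M lebesgue))"
proof -
  interpret sigma_finite_measure "lebesgue :: 'a measure"
    by (rule sigma_finite_lebesgue)
  have "(\<integral>\<^sup>+y. fractional_kernel s x y * (indicator A x * indicator B y) \<partial>lebesgue) =
      (\<integral>\<^sup>+y\<in>B. fractional_kernel s x y \<partial>lebesgue) * indicator A x" for x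
    by (cases "x \<in> A") auto
  then show ?thesis
    unfolding interaction_def
    by (subst nn_integral_fst[symmetric]) (auto intro!: nn_integral_cong)
qed

text \<open>Tonelli swaps the order of integration, and the kernel depends only on
  \<open>norm (x - y)\<close>.\<close>

lemma interaction_commute:
  assumes [measurable]: "A \<in> sets lebesgue" "B \<in> sets lebesgue"
  shows "interaction s A B = interaction s B A"
proof -
  interpret pair_sigma_finite "lebesgue :: 'a measure" "lebesgue :: 'a measure"
    by (rule pair_sigma_finite_lebesgue)
  have "interaction s A B =
      (\<integral>\<^sup>+x. \<integral>\<^sup>+y. fractional_kernel s x y * (indicator A x * indicator B y) \<partial>lebesgue \<partial>lebesgue)"
    by (subst interaction_eq_nn_integral_prod) (auto simp flip: sigma_finite_measure.nn_integral_fst[OF sigma_finite_lebesgue])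
  also have "\<dots> = (\<integral>\<^sup>+y. \<integral>\<^sup>+x. fractional_kernel s x y * (indicator A x * indicator B y) \<partial>lebesgue \<partial>lebesgue)"
    by (rule Fubini'[symmetric]) (simp add: case_prod_beta')
  also have "\<dots> = interaction s B A"
    by (subst interaction_eq_nn_integral_prod)
       (auto simp flip: sigma_finite_measure.nn_integral_fst[OF sigma_finite_lebesgue] simp: norm_minus_commute mult.commute)
  finally show ?thesis .
qed

lemma interaction_Un_left:
  assumes [measurable]: "A \<in> sets lebesgue" "A' \<in> sets lebesgue" "B \<in> sets lebesgue"
    and "A \<inter> A' = {}"
  shows "interaction s (A \<union> A') B = interaction s A B + interaction s A' B"
proof -
  have *: "indicator (A \<union> A') x = (indicator A x + indicator A' x :: ennreal)" for x
    using assms(4) by (auto simp: indicator_def)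
  show ?thesis
    by (simp add: interaction_eq_nn_integral_prod * distrib_left distrib_right nn_integral_add)
qed

lemma interaction_Un_right:
  assumes "A \<in> sets lebesgue" "B \<in> sets lebesgue" "B' \<in> sets lebesgue" "B \<inter> B' = {}"
  shows "interaction s A (B \<union> B') = interaction s A B + interaction s A B'"
  using assms interaction_Un_left[of B B' A s] by (simp add: interaction_commute[of A])

lemma interaction_mono_left:
  "A \<subseteq> A' \<Longrightarrow> interaction s A B \<le> interaction s A' B"
  unfolding interaction_def by (intro nn_integral_mono mult_left_mono) (auto simp: indicator_def)

lemma interaction_le_emeasure:
  assumes "A \<in> sets lebesgue" and "\<And>x. x \<in> A \<Longrightarrow> (\<integral>\<^sup>+y\<in>B. fractional_kernel s x y \<partial>lebesgue) \<le> M"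
  shows "interaction s A B \<le> M * emeasure lebesgue A"
proof -
  have "interaction s A B \<le> (\<integral>\<^sup>+x. M * indicator A x \<partial>lebesgue)"
    unfolding interaction_def using assms(2) by (intro nn_integral_mono) (auto simp: indicator_def)
  also have "\<dots> = M * emeasure lebesgue A"
    using assms(1) by (rule nn_integral_cmult_indicator)
  finally show ?thesis .
qed

section \<open>Adding a set outside the domain\<close>

text \<open>Stated as an identity of sums because the interactions may be infinite.\<close>

lemma Per_Un:
  assumes m: "E \<in> sets lebesgue" "K \<in> sets lebesgue" "S \<in> sets lebesgue"
    and "S \<inter> K = {}" "S \<inter> E = {}"
  shows "Per s (E \<union> S) K + interaction s (E \<inter> K) S = Per s E K + interaction s (K - E) S"
proof -
  \<comment> \<open>Adding \<open>S\<close> moves it from the complement to the exterior part of the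
    set: pairs between \<open>E \<inter> K\<close> and \<open>S\<close> are lost, pairs between
    \<open>S\<close> and \<open>K - E\<close> are gained.\<close>
  have "- E = - (E \<union> S) \<union> S" "(E \<union> S) \<inter> - K = (E \<inter> - K) \<union> S"
      "(E \<union> S) \<inter> K = E \<inter> K" "- (E \<union> S) \<inter> K = K - E" "- E \<inter> K = K - E"
    using assms by auto
  moreover have "interaction s (E \<inter> K) (- (E \<union> S) \<union> S) =
      interaction s (E \<inter> K) (- (E \<union> S)) + interaction s (E \<inter> K) S"
    using m by (intro interaction_Un_right) auto
  moreover have "interaction s ((E \<inter> - K) \<union> S) (K - E) =
      interaction s (E \<inter> - K) (K - E) + interaction s S (K - E)"
    using assms by (intro interaction_Un_left) auto
  moreover have "interaction s S (K - E) = interaction s (K - E) S"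
    using m by (intro interaction_commute) auto
  ultimately show ?thesis
    unfolding Per_def by (simp add: ac_simps)
qed

lemma interaction_le_sym_diff:
  assumes m: "A \<in> sets lebesgue" "B \<in> sets lebesgue" "S \<in> sets lebesgue"
  shows "interaction s A S \<le> interaction s B S + interaction s (sym_diff A B) S"
proof -
  have "interaction s A S = interaction s (A \<inter> B) S + interaction s (A - B) S"
    using m by (subst interaction_Un_left[symmetric]) (auto intro: arg_cong2[where f="interaction s"])
  also have "\<dots> \<le> interaction s B S + interaction s (sym_diff A B) S"
    by (intro add_mono interaction_mono_left) auto
  finally show ?thesis .
qed

text \<open>Here \<open>a, b\<close> are the perimeters of set and competitor before the change,
  \<open>a', b'\<close> those after it, and \<open>P, Q\<close> the lost and gained interactions.
  Exchanging the roles of \<open>P\<close> and \<open>Q\<close> covers both adding and removing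
  \<open>S\<close>.\<close>

lemma ennreal_transfer_minimality:
  fixes a a' b b' P P' Q Q' D l m :: ennreal
  assumes E: "a' + P = a + Q" and F: "b' + P' = b + Q'" and "a \<le> b + l"
    and "Q \<le> Q' + D" "P' \<le> P + D" "D \<le> m" "P < \<infinity>"
  shows "a' \<le> b' + (l + m + m)"
proof -
  have "P + a' = a + Q"
    using E by (simp add: add.commute)
  also have "\<dots> \<le> (b + l) + (Q' + D)"
    by (intro add_mono assms)
  also have "\<dots> = b' + P' + (l + D)"
    unfolding F by (simp add: ac_simps)
  also have "\<dots> \<le> b' + (P + D) + (l + D)"
    by (intro add_mono assms order_refl)
  also have "\<dots> = P + (b' + (l + D + D))"
    by (simp add: ac_simps)
  also have "\<dots> \<le> P + (b' + (l + m + m))"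
    by (intro add_mono assms order_refl)
  \<comment> \<open>Cancelling \<open>P\<close> on both sides is legitimate only because
    \<open>P\<close> is finite.\<close>
  finally show ?thesis
    using assms(7) by (auto simp: ennreal_add_left_cancel_le)
qed

section \<open>Transfer of minimality inside a fixed set \<open>K\<close>\<close>

context
  fixes K S :: "'b::euclidean_space set" and s M \<Lambda> :: real
  assumes K: "K \<in> sets lebesgue" "emeasure lebesgue K < \<infinity>"
    and S: "S \<in> sets lebesgue" "S \<inter> K = {}"
    and M: "0 \<le> M" "\<And>x. x \<in> K \<Longrightarrow> (\<integral>\<^sup>+y\<in>S. fractional_kernel s x y \<partial>lebesgue) \<le> ennreal M"
    and \<Lambda>: "0 \<le> \<Lambda>"
begin

lemma interaction_le_of_potential_bound:
  assumes "A \<in> sets lebesgue" "A \<subseteq> K"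
  shows "interaction s A S \<le> ennreal M * emeasure lebesgue A" "interaction s A S < \<infinity>"
proof -
  show *: "interaction s A S \<le> ennreal M * emeasure lebesgue A"
    using assms M by (intro interaction_le_emeasure) auto
  have "emeasure lebesgue A < \<infinity>"
    using emeasure_mono[OF assms(2) K(1)] K(2) by simp
  then show "interaction s A S < \<infinity>"
    using * by (simp add: ennreal_mult_less_top order.strict_trans1)
qed

text \<open>Both correction terms in \<open>Per_Un\<close> are finite, since the potential is
  bounded and \<open>K\<close> has finite measure.\<close>

lemma Per_Un_finite_iff:
  assumes "E \<in> sets lebesgue" "S \<inter> E = {}"
  shows "Per s (E \<union> S) K < \<infinity> \<longleftrightarrow> Per s E K < \<infinity>"
proof -
  have "interaction s (E \<inter> K) S < \<infinity>" "interaction s (K - E) S < \<infinity>"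
    using assms(1) K(1) by (intro interaction_le_of_potential_bound(2); auto)+
  then show ?thesis
    using Per_Un[OF assms(1) K(1) S assms(2), of s] ennreal_add_less_top
    by (metis infinity_ennreal_def)
qed

text \<open>The loss \<open>2 * M\<close> comes from two interactions with \<open>S\<close>, the
  lost and the gained one, each changing by at most \<open>M\<close> times the measure of the
  symmetric difference when \<open>E\<close> is replaced by \<open>F\<close>.\<close>

lemma competitor_Un:
  assumes E: "E \<in> sets lebesgue" "S \<inter> E = {}"
    and F: "F \<in> sets lebesgue" "sym_diff E F \<subseteq> K"
  shows "Per s E K \<le> Per s F K + ennreal \<Lambda> * emeasure lebesgue (sym_diff E F) \<Longrightarrow>
      Per s (E \<union> S) K \<le> Per s (F \<union> S) K + ennreal (\<Lambda> + 2 * M) * emeasure lebesgue (sym_diff E F)"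
    and "Per s (E \<union> S) K \<le> Per s (F \<union> S) K + ennreal \<Lambda> * emeasure lebesgue (sym_diff E F) \<Longrightarrow>
      Per s E K \<le> Per s F K + ennreal (\<Lambda> + 2 * M) * emeasure lebesgue (sym_diff E F)"
proof -
  let ?e = "emeasure lebesgue (sym_diff E F)" and ?D = "interaction s (sym_diff E F) S"
  let ?P = "interaction s (E \<inter> K) S" and ?P' = "interaction s (F \<inter> K) S"
  let ?Q = "interaction s (K - E) S" and ?Q' = "interaction s (K - F) S"
  have SF: "S \<inter> F = {}"
    using E F S by auto
  have m: "E \<inter> K \<in> sets lebesgue" "F \<inter> K \<in> sets lebesgue" "K - E \<in> sets lebesgue"
      "K - F \<in> sets lebesgue" "sym_diff E F \<in> sets lebesgue"
    using E F K(1) by auto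
  have D: "?D \<le> ennreal M * ?e"
    using m(5) F(2) by (rule interaction_le_of_potential_bound)
  have "ennreal (\<Lambda> + 2 * M) = ennreal \<Lambda> + ennreal M + ennreal M"
    using M(1) \<Lambda> by (simp flip: ennreal_plus)
  then have split: "ennreal (\<Lambda> + 2 * M) * ?e = ennreal \<Lambda> * ?e + ennreal M * ?e + ennreal M * ?e"
    by (simp only: distrib_right)
  \<comment> \<open>\<open>E\<close> and \<open>F\<close> differ only inside \<open>K\<close>, so
    restricting to \<open>K\<close> or complementing in \<open>K\<close> preserves their symmetric
    difference.\<close>
  have sd: "sym_diff (E \<inter> K) (F \<inter> K) = sym_diff E F" "sym_diff (F \<inter> K) (E \<inter> K) = sym_diff E F"
      "sym_diff (K - E) (K - F) = sym_diff E F" "sym_diff (K - F) (K - E) = sym_diff E F"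
    using F by auto
  have le: "?P \<le> ?P' + ?D" "?P' \<le> ?P + ?D" "?Q \<le> ?Q' + ?D" "?Q' \<le> ?Q + ?D"
    using interaction_le_sym_diff[OF m(1,2) S(1), of s] interaction_le_sym_diff[OF m(2,1) S(1), of s]
      interaction_le_sym_diff[OF m(3,4) S(1), of s] interaction_le_sym_diff[OF m(4,3) S(1), of s]
    unfolding sd .
  have fin: "?P < \<infinity>" "?Q < \<infinity>"
    using m by (intro interaction_le_of_potential_bound(2); auto)+
  note PE = Per_Un[OF E(1) K(1) S E(2), of s] and PF = Per_Un[OF F(1) K(1) S SF, of s]
  show "Per s (E \<union> S) K \<le> Per s (F \<union> S) K + ennreal (\<Lambda> + 2 * M) * ?e"
    if "Per s E K \<le> Per s F K + ennreal \<Lambda> * ?e"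
    unfolding split using PE PF that le(3,2) D fin(1) by (rule ennreal_transfer_minimality)
  show "Per s E K \<le> Per s F K + ennreal (\<Lambda> + 2 * M) * ?e"
    if "Per s (E \<union> S) K \<le> Per s (F \<union> S) K + ennreal \<Lambda> * ?e"
    unfolding split using PE[symmetric] PF[symmetric] that le(1,4) D fin(2)
    by (rule ennreal_transfer_minimality)
qed

text \<open>As \<open>S\<close> misses \<open>K\<close>, every competitor of
  \<open>E \<union> S\<close> contains \<open>S\<close>; removing \<open>S\<close> from it leaves a
  competitor of \<open>E\<close> with the same symmetric difference.\<close>

lemma Lambda_minimal_in_Un:
  assumes E: "E \<in> sets lebesgue" "S \<inter> E = {}" and min: "Lambda_minimal_in s \<Lambda> K E"
  shows "Lambda_minimal_in s (\<Lambda> + 2 * M) K (E \<union> S)"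
  unfolding Lambda_minimal_in_def
proof (intro conjI ballI impI)
  show "Per s (E \<union> S) K < \<infinity>"
    using min Per_Un_finite_iff[OF E] by (simp add: Lambda_minimal_in_def)
  fix F :: "'b set" assume F: "F \<in> sets lebesgue" "sym_diff (E \<union> S) F \<subseteq> K"
  then have "F = (F - S) \<union> S" "sym_diff E (F - S) = sym_diff (E \<union> S) F"
    using S E by auto
  moreover have "F - S \<in> sets lebesgue"
    using F S by auto
  ultimately show "Per s (E \<union> S) K \<le>
      Per s F K + ennreal (\<Lambda> + 2 * M) * emeasure lebesgue (sym_diff (E \<union> S) F)"
    using competitor_Un(1)[OF E, of "F - S"] min F(2)
    unfolding Lambda_minimal_in_def by metis
qed

text \<open>Conversely, a competitor of \<open>E\<close> is disjoint from \<open>S\<close>, so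
  adding \<open>S\<close> to it does not alter the symmetric difference.\<close>

lemma Lambda_minimal_in_of_Un:
  assumes E: "E \<in> sets lebesgue" "S \<inter> E = {}" and min: "Lambda_minimal_in s \<Lambda> K (E \<union> S)"
  shows "Lambda_minimal_in s (\<Lambda> + 2 * M) K E"
  unfolding Lambda_minimal_in_def
proof (intro conjI ballI impI)
  show "Per s E K < \<infinity>"
    using min Per_Un_finite_iff[OF E] by (simp add: Lambda_minimal_in_def)
  fix F :: "'b set" assume F: "F \<in> sets lebesgue" "sym_diff E F \<subseteq> K"
  then have "sym_diff (E \<union> S) (F \<union> S) = sym_diff E F" "F \<union> S \<in> sets lebesgue"
    using S E by auto
  then show "Per s E K \<le> Per s F K + ennreal (\<Lambda> + 2 * M) * emeasure lebesgue (sym_diff E F)"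
    using competitor_Un(2)[OF E F] min F(2)
    unfolding Lambda_minimal_in_def by metis
qed

end

section \<open>The potential of a thin set\<close>

lemma exists_dyadic_between:
  fixes t \<delta> :: real
  assumes "0 < t" "t < \<delta>"
  shows "\<exists>k. \<delta> * (1/2) ^ Suc k \<le> t \<and> t < \<delta> * (1/2) ^ k"
proof -
  define P where "P n \<longleftrightarrow> \<delta> * (1/2) ^ n \<le> t" for n :: nat
  obtain n where "(1/2) ^ n < t / \<delta>"
    using assms real_arch_pow_inv[of "t / \<delta>" "1/2"] by auto
  then have "P n"
    using assms by (simp add: P_def field_simps)
  then have "P (LEAST n. P n)"
    by (rule LeastI)
  moreover have "\<not> P 0"
    using assms by (simp add: P_def)
  \<comment> \<open>The least index with \<open>P\<close> is positive because
    \<open>t < \<delta>\<close>; its predecessor is the required \<open>k\<close>.\<close>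
  ultimately obtain k where k: "(LEAST n. P n) = Suc k" "P (Suc k)"
    by (metis not0_implies_Suc)
  then have "\<not> P k"
    using not_less_Least[of k P] by simp
  then show ?thesis
    using k by (auto simp: P_def not_le)
qed

text \<open>The volume is linear in \<open>h\<close> because \<open>(1 + h) ^ d - 1\<close> has the
  factor \<open>h\<close>; the cofactor is a geometric sum, bounded by its value at
  \<open>h = \<delta>\<close>, so \<open>c\<close> does not depend on \<open>h\<close>.\<close>

lemma emeasure_annulus_le:
  assumes "0 < \<delta>"
  obtains c where "0 \<le> c" and
    "\<And>h. 0 \<le> h \<Longrightarrow> h \<le> \<delta> \<Longrightarrow>
      emeasure lborel (ball 0 (1 + h) - cball (0::'a::euclidean_space) 1) \<le> ennreal (c * h)"
proof
  let ?v = "unit_ball_vol (real DIM('a))"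
  define c where "c = ?v * (\<Sum>i<DIM('a). (1 + \<delta>) ^ i)"
  show "0 \<le> c"
    using assms by (auto simp: c_def intro!: mult_nonneg_nonneg sum_nonneg)
  fix h :: real assume h: "0 \<le> h" "h \<le> \<delta>"
  have "emeasure lborel (ball 0 (1 + h) - cball (0::'a) 1) \<le>
      emeasure lborel (cball (0::'a) (1 + h) - cball (0::'a) 1)"
    by (intro emeasure_mono) auto
  also have "\<dots> = emeasure lborel (cball (0::'a) (1 + h)) - emeasure lborel (cball (0::'a) 1)"
    using h by (intro emeasure_Diff) (auto simp: emeasure_cball)
  also have "\<dots> = ennreal (?v * ((1 + h) ^ DIM('a) - 1))"
    using h by (simp add: emeasure_cball ennreal_minus right_diff_distrib)
  also have "(1 + h) ^ DIM('a) - 1 = h * (\<Sum>i<DIM('a). (1 + h) ^ i)"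
    by (subst power_diff_1_eq) auto
  also have "ennreal (?v * (h * (\<Sum>i<DIM('a). (1 + h) ^ i))) \<le> ennreal (?v * (h * (\<Sum>i<DIM('a). (1 + \<delta>) ^ i)))"
    using h by (intro ennreal_leI mult_left_mono sum_mono power_mono) auto
  finally show "emeasure lborel (ball 0 (1 + h) - cball (0::'a) 1) \<le> ennreal (c * h)"
    by (simp add: c_def ac_simps)
qed

text \<open>The annulus is cut into dyadic layers; the layer at distance about \<open>2\<^sup>-\<^sup>k\<close> from the unit
  sphere contributes about \<open>2\<^bsup>-k\<xi>\<^esup>\<close>.\<close>

lemma nn_integral_annulus_powr_finite:
  assumes "0 < \<delta>" "0 < \<xi>"
  shows "(\<integral>\<^sup>+y\<in>(ball 0 (1 + \<delta>) - cball (0::'a::euclidean_space) 1).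
      ennreal ((norm y - 1) powr (\<xi> - 1)) \<partial>lborel) < \<infinity>"
proof -
  obtain c where c: "0 \<le> c" "\<And>h. 0 \<le> h \<Longrightarrow> h \<le> \<delta> \<Longrightarrow>
      emeasure lborel (ball 0 (1 + h) - cball (0::'a) 1) \<le> ennreal (c * h)"
    using emeasure_annulus_le[OF assms(1)] by blast
  define h where "h k = \<delta> * (1/2) ^ k" for k :: nat
  \<comment> \<open>Bound for the weight on the layer from \<open>h (Suc k)\<close> to
    \<open>h k\<close>: writing it as \<open>t powr \<xi> / t\<close>, the numerator is largest at
    \<open>h k\<close> and the denominator smallest at \<open>h k / 2\<close>. This avoids a case
    distinction on the sign of \<open>\<xi> - 1\<close>.\<close>
  define b where "b k = 2 * h k powr \<xi> / h k" for k :: nat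
  \<comment> \<open>These are nested full annuli rather than disjoint layers; only an upper bound is
    sought, so the overlap is harmless.\<close>
  define A where "A k = ball 0 (1 + h k) - cball (0::'a) 1" for k
  have h: "0 < h k" "h k \<le> \<delta>" "h (Suc k) = h k / 2" for k
    using assms by (auto simp: h_def power_le_one)
  have b0: "0 \<le> b k" for k
    using h(1)[of k] by (simp add: b_def)
  have [measurable]: "A k \<in> sets borel" for k
    by (simp add: A_def)
  have "(\<integral>\<^sup>+y\<in>(ball 0 (1 + \<delta>) - cball (0::'a) 1). ennreal ((norm y - 1) powr (\<xi> - 1)) \<partial>lborel) \<le>
      (\<integral>\<^sup>+y. (\<Sum>k. ennreal (b k) * indicator (A k) y) \<partial>lborel)"
  proof (intro nn_integral_mono)
    fix y :: 'a
    show "ennreal ((norm y - 1) powr (\<xi> - 1)) * indicator (ball 0 (1 + \<delta>) - cball 0 1) y \<le>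
        (\<Sum>k. ennreal (b k) * indicator (A k) y)"
    proof (cases "y \<in> ball 0 (1 + \<delta>) - cball 0 1")
      case True
      define t where "t = norm y - 1"
      have t: "0 < t" "t < \<delta>"
        using True by (auto simp: t_def)
      then obtain k where k: "h (Suc k) \<le> t" "t < h k"
        using exists_dyadic_between[of t \<delta>] by (auto simp: h_def)
      have "t powr (\<xi> - 1) = t powr \<xi> / t"
        using t by (simp add: powr_diff)
      also have "\<dots> \<le> h k powr \<xi> / h (Suc k)"
        using t k h[of k] h(1)[of "Suc k"] assms by (intro frac_le powr_mono2) auto
      also have "\<dots> = b k"
        by (simp add: b_def h(3))
      finally have "ennreal (t powr (\<xi> - 1)) \<le> ennreal (b k) * indicator (A k) y"
        using True k by (auto simp: A_def t_def intro!: ennreal_leI)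
      also have "\<dots> \<le> (\<Sum>k. ennreal (b k) * indicator (A k) y)"
        using sum_le_suminf[OF summableI, of "{k}" "\<lambda>k. ennreal (b k) * indicator (A k) y"]
        by (simp del: sum_mult_indicator)
      finally show ?thesis
        using True by (simp add: t_def)
    qed auto
  qed
  also have "\<dots> = (\<Sum>k. \<integral>\<^sup>+y. ennreal (b k) * indicator (A k) y \<partial>lborel)"
    by (intro nn_integral_suminf) auto
  also have "\<dots> = (\<Sum>k. ennreal (b k) * emeasure lborel (A k))"
    by (simp add: nn_integral_cmult_indicator)
  \<comment> \<open>The measure of \<open>A k\<close> is at most \<open>c * h k\<close>, which
    cancels the denominator of \<open>b k\<close> and leaves a geometric series of ratio
    \<open>(1/2) powr \<xi> < 1\<close>.\<close>
  also have "\<dots> \<le> (\<Sum>k. ennreal (2 * c * \<delta> powr \<xi> * ((1/2) powr \<xi>) ^ k))"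
  proof (intro suminf_le)
    fix k
    have "ennreal (b k) * emeasure lborel (A k) \<le> ennreal (b k) * ennreal (c * h k)"
      unfolding A_def using h[of k] by (intro mult_left_mono c) auto
    also have "\<dots> = ennreal (b k * (c * h k))"
      using b0 c(1) h(1)[of k] by (simp add: ennreal_mult)
    also have "b k * (c * h k) = 2 * c * h k powr \<xi>"
      using h(1)[of k] by (simp add: b_def)
    also have "h k powr \<xi> = \<delta> powr \<xi> * ((1/2) powr \<xi>) ^ k"
      using assms by (simp add: h_def powr_mult powr_power powr_powr mult.commute flip: powr_realpow)
    finally show "ennreal (b k) * emeasure lborel (A k) \<le> ennreal (2 * c * \<delta> powr \<xi> * ((1/2) powr \<xi>) ^ k)"
      by (simp add: mult.assoc)
  qed auto
  also have "\<dots> < \<infinity>"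
  proof -
    have "(1/2::real) powr \<xi> < 1"
      using powr_less_mono2[OF assms(2), of "1/2" 1] by simp
    then have "summable (\<lambda>k. 2 * c * \<delta> powr \<xi> * ((1/2) powr \<xi>) ^ k)"
      by (intro summable_mult summable_geometric) auto
    then show ?thesis
      using c(1) assms by (subst suminf_ennreal2) auto
  qed
  finally show ?thesis .
qed

section \<open>Vertical slices of the thin region\<close>

lemma sphere_times_UNIV_null:
  "sphere (0::'a::euclidean_space) r \<times> (UNIV :: 'b::euclidean_space set) \<in> null_sets lborel"
proof -
  have "sphere (0::'a) r \<in> null_sets lborel"
    using negligible_sphere[of "0::'a" r] by (simp add: negligible_iff_null_sets null_sets_completion_iff)
  \<comment> \<open>The other factor has infinite measure, but \<open>0 * \<infinity> = 0\<close> in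
    \<open>ennreal\<close>.\<close>
  then show ?thesis
    by (simp add: null_sets_def flip: lborel_prod)
       (simp add: lborel.emeasure_pair_measure_Times)
qed

lemma C1_Holder_borel_measurable:
  assumes "C1_Holder \<alpha> \<psi>"
  shows "\<psi> \<in> borel_measurable borel"
proof (rule borel_measurable_continuous_onI)
  show "continuous_on UNIV \<psi>"
    using assms unfolding C1_Holder_def gderiv_def
    by (meson continuous_at_imp_continuous_on has_derivative_continuous)
qed

lemma thin_region_translate_borel:
  fixes \<psi> :: "'a::euclidean_space \<Rightarrow> real"
  assumes [measurable]: "\<psi> \<in> borel_measurable borel"
  shows "{y. y + (0, t) \<in> thin_region s \<psi> \<delta> C \<xi>} \<in> sets borel"
proof -
  let ?q = "real DIM('a \<times> real) + s - 1 + \<xi>"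
  have [measurable]: "(fst :: 'a \<times> real \<Rightarrow> 'a) \<in> borel \<rightarrow>\<^sub>M borel"
      "(snd :: 'a \<times> real \<Rightarrow> real) \<in> borel \<rightarrow>\<^sub>M borel"
    by (auto intro!: borel_measurable_continuous_onI continuous_intros)
  have "{y. y + (0, t) \<in> thin_region s \<psi> \<delta> C \<xi>} = {y \<in> space borel. 1 < norm (fst y) \<and>
      norm (fst y) < 1 + \<delta> \<and> \<psi> (fst y) < snd y + t \<and>
      snd y + t < \<psi> (fst y) + C * (norm (fst y) - 1) powr ?q}"
    by (auto simp: thin_region_def)
  also have "\<dots> \<in> sets borel"
    by measurable
  finally show ?thesis .
qed

text \<open>Integrating first in the vertical direction turns the thickness
  \<open>C (|x'| - 1)\<^bsup>n + s - 1 + \<xi>\<^esup>\<close> into the weight \<open>C (|x'| - 1)\<^bsup>\<xi> - 1\<^esup>\<close>.\<close>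

lemma nn_integral_thin_region_finite:
  fixes \<psi> :: "'a::euclidean_space \<Rightarrow> real"
  assumes [measurable]: "\<psi> \<in> borel_measurable borel" and "0 < \<delta>" "0 < \<xi>" "0 < C"
  shows "(\<integral>\<^sup>+y\<in>{y. y + (0, t) \<in> thin_region s \<psi> \<delta> C \<xi>}.
      ennreal (1 / (norm (fst y) - 1) powr (real DIM('a \<times> real) + s)) \<partial>lborel) < \<infinity>"
proof -
  define p where "p = real DIM('a \<times> real) + s"
  define R where "R = ball 0 (1 + \<delta>) - cball (0::'a) 1"
  \<comment> \<open>\<open>I x\<close> is the vertical slice of the translated region over
    \<open>x\<close>; the translation shifts it without changing its length.\<close>
  define I where "I x = {\<psi> x - t <..< \<psi> x - t + C * (norm x - 1) powr (p - 1 + \<xi>)}" for x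
  define G where "G = {y. y + (0, t) \<in> thin_region s \<psi> \<delta> C \<xi>}"
  have G: "(x, r) \<in> G \<longleftrightarrow> x \<in> R \<and> r \<in> I x" for x r
    by (auto simp: G_def thin_region_def R_def I_def p_def)
  have [measurable]: "R \<in> sets borel"
    by (simp add: R_def)
  have [measurable]: "G \<in> sets (lborel \<Otimes>\<^sub>M lborel)"
    unfolding G_def lborel_prod using thin_region_translate_borel[OF assms(1)] by simp
  let ?w = "\<lambda>x::'a. ennreal (1 / (norm x - 1) powr p)"
  have "(\<integral>\<^sup>+y\<in>G. ?w (fst y) \<partial>lborel) = (\<integral>\<^sup>+x. \<integral>\<^sup>+r. ?w x * indicator G (x, r) \<partial>lborel \<partial>lborel)"
    by (subst lborel_prod[symmetric], subst lborel.nn_integral_fst[symmetric]) auto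
  also have "\<dots> = (\<integral>\<^sup>+x. ennreal C * (ennreal ((norm x - 1) powr (\<xi> - 1)) * indicator R x) \<partial>lborel)"
  proof (intro nn_integral_cong)
    fix x :: 'a
    show "(\<integral>\<^sup>+r. ?w x * indicator G (x, r) \<partial>lborel) =
        ennreal C * (ennreal ((norm x - 1) powr (\<xi> - 1)) * indicator R x)"
    proof (cases "x \<in> R")
      case True
      define u where "u = norm x - 1"
      have u: "0 < u"
        using True by (auto simp: R_def u_def)
      have "(\<integral>\<^sup>+r. ?w x * indicator G (x, r) \<partial>lborel) = (\<integral>\<^sup>+r. ?w x * indicator (I x) r \<partial>lborel)"
        using True by (intro nn_integral_cong) (auto simp: G indicator_def)
      also have "\<dots> = ?w x * emeasure lborel (I x)"
        by (intro nn_integral_cmult_indicator) (simp add: I_def)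
      also have "\<dots> = ennreal (1 / u powr p * (C * u powr (p - 1 + \<xi>)))"
        using assms(4) by (simp add: I_def u_def flip: ennreal_mult')
      also have "1 / u powr p * (C * u powr (p - 1 + \<xi>)) = C * u powr (\<xi> - 1)"
        using u by (simp add: powr_diff powr_add)
      finally show ?thesis
        using True assms(4) by (simp add: u_def ennreal_mult)
    qed (auto simp: G)
  qed
  also have "\<dots> = ennreal C * (\<integral>\<^sup>+x\<in>R. ennreal ((norm x - 1) powr (\<xi> - 1)) \<partial>lborel)"
    by (intro nn_integral_cmult) measurable
  also have "\<dots> < \<infinity>"
    using nn_integral_annulus_powr_finite[OF assms(2,3), where 'a='a]
    by (simp add: R_def ennreal_mult_less_top)
  finally show ?thesis
    by (simp add: G_def p_def)
qed

section \<open>Uniform bound on the potential\<close>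

lemma kernel_le_distance_to_cylinder:
  fixes x y :: "'a::euclidean_space \<times> real"
  assumes "x \<in> cylinder" "1 < norm (fst y)" "0 < s"
  shows "fractional_kernel s x y \<le> ennreal (1 / (norm (fst y) - 1) powr (real DIM('a \<times> real) + s))"
proof -
  have "norm (fst x) < 1"
    using assms(1) by (auto simp: cylinder_def)
  then have "norm (fst y) - 1 \<le> norm (fst (x - y))"
    using norm_triangle_ineq2[of "fst y" "fst x"] by (simp add: norm_minus_commute)
  also have "\<dots> \<le> norm (x - y)"
    by (metis norm_fst_le prod.collapse)
  finally show ?thesis
    using assms by (intro ennreal_leI divide_left_mono powr_mono2 mult_pos_pos) auto
qed

text \<open>\<open>S\<close> is split by horizontal distance. Points with
  \<open>norm (fst y) < 1 + \<delta>\<close> lie in the translated thin region, up to the null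
  lateral boundary of the cylinder; at the others the kernel is at most \<open>a\<close>, and the
  boundedness of \<open>S\<close> makes its measure finite.\<close>

lemma potential_bounded_on_cylinder:
  fixes S :: "('a::euclidean_space \<times> real) set"
  assumes s: "0 < s" and S: "S \<in> sets lebesgue" "S \<subseteq> - cylinder" "bounded S"
    and pos: "0 < \<delta>" "0 < C" "0 < \<xi>"
    and \<psi>: "\<psi> \<in> borel_measurable borel"
    and thin: "(\<lambda>y. y + t *\<^sub>R (0, 1)) ` S \<inter> ((ball 0 (1 + \<delta>) - closure (ball 0 1)) \<times> UNIV)
      \<subseteq> thin_region s \<psi> \<delta> C \<xi>"
  obtains M where "0 \<le> M"
    "\<And>x. x \<in> cylinder \<Longrightarrow> (\<integral>\<^sup>+y\<in>S. fractional_kernel s x y \<partial>lebesgue) \<le> ennreal M"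
proof -
  let ?w = "\<lambda>y::'a \<times> real. ennreal (1 / (norm (fst y) - 1) powr (real DIM('a \<times> real) + s))"
  define a where "a = 1 / \<delta> powr (real DIM('a \<times> real) + s)"
  define G where "G = {y. y + (0, t) \<in> thin_region s \<psi> \<delta> C \<xi>}"
  define N where "N = (\<integral>\<^sup>+y\<in>G. ?w y \<partial>lborel) + ennreal a * emeasure lebesgue S"
  have "emeasure lebesgue S < \<infinity>"
    using fmeasurableD2[OF bounded_set_imp_lmeasurable[OF S(3,1)]] by (simp add: less_top)
  moreover have "(\<integral>\<^sup>+y\<in>G. ?w y \<partial>lborel) < \<infinity>"
    unfolding G_def using nn_integral_thin_region_finite \<psi> pos by blast
  ultimately have N: "N < \<infinity>"
    by (simp add: N_def ennreal_mult_less_top)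
  have "(\<integral>\<^sup>+y\<in>S. fractional_kernel s x y \<partial>lebesgue) \<le> N" if x: "x \<in> cylinder" for x
  proof -
    have ae: "AE y in lebesgue. y \<notin> sphere (0::'a) 1 \<times> (UNIV :: real set)"
      using AE_not_in[OF sphere_times_UNIV_null] by (rule AE_completion)
    note [measurable] = S(1)
    have mG: "G \<in> sets borel"
      unfolding G_def by (rule thin_region_translate_borel[OF \<psi>])
    have "(\<integral>\<^sup>+y\<in>S. fractional_kernel s x y \<partial>lebesgue) \<le>
        (\<integral>\<^sup>+y. ?w y * indicator G y + ennreal a * indicator S y \<partial>lebesgue)"
    proof (rule nn_integral_mono_AE, use ae in eventually_elim)
      fix y :: "'a \<times> real" assume y: "y \<notin> sphere 0 1 \<times> UNIV"
      show "fractional_kernel s x y * indicator S y \<le> ?w y * indicator G y + ennreal a * indicator S y"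
      proof (cases "y \<in> S")
        case True
        then have "norm (fst y) \<ge> 1"
          using S(2) by (cases y) (auto simp: cylinder_def not_less)
        then have n1: "1 < norm (fst y)"
          using y by (cases y) auto
        note k = kernel_le_distance_to_cylinder[OF x n1 s]
        show ?thesis
        proof (cases "norm (fst y) < 1 + \<delta>")
          case close: True
          have "y + t *\<^sub>R (0, 1) \<in> (ball 0 (1 + \<delta>) - closure (ball 0 1)) \<times> UNIV"
            using close n1 by (cases y) auto
          then have "y + t *\<^sub>R (0, 1) \<in> thin_region s \<psi> \<delta> C \<xi>"
            by (rule subsetD[OF thin IntI[OF imageI[OF True]]])
          then have "y \<in> G"
            by (simp add: G_def)
          then show ?thesis
            using k True by (simp add: add_increasing2)
        next
          case False
          have "?w y \<le> ennreal a"
            unfolding a_def using False pos s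
            by (intro ennreal_leI divide_left_mono powr_mono2 mult_pos_pos) auto
          with k have "fractional_kernel s x y \<le> ennreal a"
            by (rule order.trans)
          then show ?thesis
            using True by (simp add: add_increasing)
        qed
      qed simp
    qed
    also have "\<dots> = (\<integral>\<^sup>+y\<in>G. ?w y \<partial>lebesgue) + (\<integral>\<^sup>+y. ennreal a * indicator S y \<partial>lebesgue)"
    proof (rule nn_integral_add)
      have [measurable]: "(fst :: 'a \<times> real \<Rightarrow> 'a) \<in> borel \<rightarrow>\<^sub>M borel"
        by (intro borel_measurable_continuous_onI continuous_intros)
      have "(\<lambda>y. ?w y * indicator G y) \<in> borel_measurable lborel"
        using mG by measurable
      then show "(\<lambda>y. ?w y * indicator G y) \<in> borel_measurable lebesgue"
        by (rule measurable_completion)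
    qed measurable
    \<comment> \<open>Integrals against \<open>lebesgue\<close> and \<open>lborel\<close> agree
      here, so the estimate obtained by vertical slicing applies.\<close>
    also have "\<dots> = N"
      unfolding N_def nn_integral_cmult_indicator[OF S(1)] by (simp only: nn_integral_completion)
    finally show ?thesis .
  qed
  then show thesis
    using N that[of "enn2real N"] by (simp add: ennreal_enn2real_if less_top[symmetric])
qed

section \<open>The equivalence on the cylinder\<close>

theorem theorem1p11:
  fixes s \<delta> \<alpha> C \<xi> :: real
    and E S :: "((real ^ 'm) \<times> real) set"
    and \<psi> :: "real ^ 'm \<Rightarrow> real"
    and \<tau> :: "(real ^ 'm) \<times> real \<Rightarrow> (real ^ 'm) \<times> real"
  assumes "0 < s" and "s < 1"
    and "E \<in> sets lebesgue" and "S \<in> sets lebesgue"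
    and "S \<subseteq> - cylinder \<inter> - E" and "bounded S"
    and "0 < \<delta>"
    and "0 < \<alpha>" and "\<alpha> < 1" and "C1_Holder \<alpha> \<psi>"
    and "vertical_translation \<tau>"
    and "eq_in (enlargement \<delta> cylinder - cylinder) E (subgraph \<psi>)"
    and "0 < C" and "0 < \<xi>"
    and "\<tau> ` S \<inter> ((ball 0 (1 + \<delta>) - closure (ball 0 1)) \<times> UNIV) \<subseteq> thin_region s \<psi> \<delta> C \<xi>"
  shows "(\<exists>\<Lambda>\<ge>0. Lambda_minimizer s \<Lambda> cylinder (E - cylinder) E) \<longleftrightarrow>
         (\<exists>\<Lambda>'\<ge>0. Lambda_minimizer s \<Lambda>' cylinder ((E \<union> S) - cylinder) (E \<union> S))"
proof -
  obtain t where \<tau>: "\<tau> = (\<lambda>x. x + t *\<^sub>R (0, 1))"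
    using assms(11) by (auto simp: vertical_translation_def)
  obtain M where M: "0 \<le> M"
      "\<And>x. x \<in> cylinder \<Longrightarrow> (\<integral>\<^sup>+y\<in>S. fractional_kernel s x y \<partial>lebesgue) \<le> ennreal M"
    using potential_bounded_on_cylinder[OF assms(1,4) _ assms(6,7,13,14)
        C1_Holder_borel_measurable[OF assms(10)] assms(15)[unfolded \<tau>]] assms(5) by auto
  have SE: "S \<inter> E = {}" and SK: "K \<subseteq> cylinder \<Longrightarrow> S \<inter> K = {}" for K
    using assms(5) by auto
  \<comment> \<open>Bounded open sets have finite measure, as the transfer of minimality
    requires.\<close>
  have K: "K \<in> sets lebesgue" "emeasure lebesgue K < \<infinity>"
    if "bounded K" "open_Lipschitz K" for K :: "((real ^ 'm) \<times> real) set"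
    using that fmeasurableD2[OF bounded_set_imp_lmeasurable[of K]]
    by (auto simp: open_Lipschitz_def top.not_eq_extremum simp del: emeasure_completion)
  have sum: "0 \<le> \<Lambda> + 2 * M" if "0 \<le> \<Lambda>" for \<Lambda>
    using that M(1) by simp
  show ?thesis
  proof (intro iffI; elim exE conjE)
    fix \<Lambda> :: real
    assume \<Lambda>: "0 \<le> \<Lambda>" and min: "Lambda_minimizer s \<Lambda> cylinder (E - cylinder) E"
    \<comment> \<open>\<open>M\<close> bounds the potential on the whole cylinder, so one constant
      \<open>\<Lambda> + 2 * M\<close> works for all \<open>L\<close> at once.\<close>
    have "Lambda_minimal_in s (\<Lambda> + 2 * M) L (E \<union> S)"
      if L: "bounded L \<and> open_Lipschitz L \<and> L \<subseteq> cylinder" for L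
    proof (rule Lambda_minimal_in_Un[OF _ _ assms(4) SK M(1) M(2) \<Lambda> assms(3) SE])
      show "Lambda_minimal_in s \<Lambda> L E"
        using min L by (simp only: Lambda_minimizer_def)
    qed (use L K in blast)+
    then show "\<exists>\<Lambda>'\<ge>0. Lambda_minimizer s \<Lambda>' cylinder ((E \<union> S) - cylinder) (E \<union> S)"
      unfolding Lambda_minimizer_def using sum[OF \<Lambda>] by (intro exI[of _ "\<Lambda> + 2 * M"] conjI allI impI refl)
  next
    fix \<Lambda> :: real
    assume \<Lambda>: "0 \<le> \<Lambda>" and min: "Lambda_minimizer s \<Lambda> cylinder ((E \<union> S) - cylinder) (E \<union> S)"
    have "Lambda_minimal_in s (\<Lambda> + 2 * M) L E"
      if L: "bounded L \<and> open_Lipschitz L \<and> L \<subseteq> cylinder" for L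
    proof (rule Lambda_minimal_in_of_Un[OF _ _ assms(4) SK M(1) M(2) \<Lambda> assms(3) SE])
      show "Lambda_minimal_in s \<Lambda> L (E \<union> S)"
        using min L by (simp only: Lambda_minimizer_def)
    qed (use L K in blast)+
    then show "\<exists>\<Lambda>\<ge>0. Lambda_minimizer s \<Lambda> cylinder (E - cylinder) E"
      unfolding Lambda_minimizer_def using sum[OF \<Lambda>] by (intro exI[of _ "\<Lambda> + 2 * M"] conjI allI impI refl)
  qed
qed

end
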